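(* Let $p\ge 1$ be an integer, let $a_1,\dots,a_p\in\mathbb{R}$ and $\lambda>0$, and let $(X_n)_{n\ge 0}$ be the Markov chain on $\mathbb{N}^p$ associated with the discrete-time Hawkes process with memory $p$ and parameters $a_1,\dots,a_p,\lambda$. If $(a_1)_+ + \cdots + (a_p)_+ < 1$, then $(X_n)_{n\ge 0}$ is a geometrically ergodic Markov chain.
   Context: $\mathbb{N}=\{0,1,2,\dots\}$ and $(x)_+=\max(0,x)$. $\mathcal{P}(\rho)$ denotes the Poisson distribution with parameter $\rho\ge 0$ (with $\mathcal{P}(0)$ the Dirac mass at $0$). The discrete-time Hawkes process with memory $p$ and parameters $a_1,\dots,a_p\in\mathbb{R}$, $\lambda>0$ is the process $(\tilde X_n)_{n\ge -p+1}$ with values in $\mathbb{N}$ such that, for all $n\ge 1$, conditionally on the past, $\tilde X_n\sim\mathcal{P}\big((a_1\tilde X_{n-1}+\cdots+a_p\tilde X_{n-p}+\lambda)_+\big)$. The associated Markov chain is $X_n=(\tilde X_n,\tilde X_{n-1},\dots,\tilde X_{n-p+1})\in\mathbb{N}^p$. Its transition matrix is $P\big((x_1,\dots,x_p),(\ell,x_1,\dots,x_{p-1})\big)=e^{-s}s^{\ell}/\ell!$ for $\ell\in\mathbb{N}$, where $s=(a_1x_1+\cdots+a_px_p+\lambda)_+$ (with the convention $0^0=1$), and $P(x,y)=0$ if $y$ is not of this form. The chain is called geometrically ergodic if it admits a stationary probability distribution $\pi$ and the law of $X_n$ converges exponentially fast in total variation to $\pi$, i.e. there is $\rho\in(0,1)$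 and, for every initial state $x$, a constant $C_x<\infty$ such that $\|P^n(x,\cdot)-\pi\|_{TV}\le C_x\rho^n$ for all $n\ge0$. *)

theory Defs
  imports "HOL-Probability.Probability"
begin

text \<open>Poisson distribution with parameter \<open>r \<ge> 0\<close>. The library's \<^const>\<open>poisson_pmf\<close> is only
  specified for positive parameters; at \<open>0\<close> we take the Dirac mass at \<open>0\<close>.\<close>

definition poisson :: "real \<Rightarrow> nat pmf" where
  "poisson r = (if r > 0 then poisson_pmf r else return_pmf 0)"

lemma pmf_poisson_nonneg:
  assumes "r \<ge> 0"
  shows "pmf (poisson r) l = exp (- r) * r ^ l / fact l"
  using assms by (cases l) (auto simp: poisson_def)

text \<open>A vector \<open>(x\<^sub>1, \<dots>, x\<^sub>p)\<close> of \<open>\<nat>\<^sup>p\<close> is a list of length \<open>p\<close>, so \<open>x\<^sub>i\<close> is \<open>x ! (i - 1)\<close>.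
  The coefficients \<open>a\<^sub>1, \<dots>, a\<^sub>p\<close> are the values of \<open>a\<close> on \<open>{1..p}\<close>; other values are not used.\<close>

definition hawkes_states :: "nat \<Rightarrow> nat list set" where
  "hawkes_states p = {x. length x = p}"

definition hawkes_intensity :: "nat \<Rightarrow> (nat \<Rightarrow> real) \<Rightarrow> real \<Rightarrow> nat list \<Rightarrow> real" where
  "hawkes_intensity p a lam x = max 0 ((\<Sum>i=1..p. a i * real (x ! (i - 1))) + lam)"

definition hawkes_kernel :: "nat \<Rightarrow> (nat \<Rightarrow> real) \<Rightarrow> real \<Rightarrow> nat list \<Rightarrow> nat list pmf" where
  "hawkes_kernel p a lam x =
     map_pmf (\<lambda>l. l # butlast x) (poisson (hawkes_intensity p a lam x))"

text \<open>The entries of the transition matrix, with \<open>0 ^ 0 = 1\<close>.\<close>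

lemma pmf_hawkes_kernel_shift:
  "pmf (hawkes_kernel p a lam x) (l # butlast x) =
     exp (- hawkes_intensity p a lam x) * hawkes_intensity p a lam x ^ l / fact l"
proof -
  have "inj (\<lambda>l. l # butlast x)"
    by (simp add: inj_def)
  then have "pmf (hawkes_kernel p a lam x) (l # butlast x) =
      pmf (poisson (hawkes_intensity p a lam x)) l"
    unfolding hawkes_kernel_def by (rule pmf_map_inj')
  then show ?thesis
    by (simp add: pmf_poisson_nonneg hawkes_intensity_def)
qed

lemma pmf_hawkes_kernel_other:
  assumes "\<And>l. y \<noteq> l # butlast x"
  shows "pmf (hawkes_kernel p a lam x) y = 0"
  using assms by (auto simp: hawkes_kernel_def pmf_eq_0_set_pmf)

lemma set_hawkes_kernel:
  assumes "p \<ge> 1" "x \<in> hawkes_states p"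
  shows "set_pmf (hawkes_kernel p a lam x) \<subseteq> hawkes_states p"
  using assms by (auto simp: hawkes_kernel_def hawkes_states_def)

text \<open>\<open>kernel_power K n x\<close> is \<open>P\<^sup>n(x, \<cdot>)\<close>, the law at time \<open>n\<close> of the Markov chain with
  transition kernel \<open>K\<close> started at \<open>x\<close>.\<close>

primrec kernel_power :: "('a \<Rightarrow> 'a pmf) \<Rightarrow> nat \<Rightarrow> 'a \<Rightarrow> 'a pmf" where
  "kernel_power K 0 x = return_pmf x"
| "kernel_power K (Suc n) x = bind_pmf (kernel_power K n x) K"

definition tv_dist :: "'a pmf \<Rightarrow> 'a pmf \<Rightarrow> real" where
  "tv_dist \<mu> \<nu> = (SUP A. \<bar>measure_pmf.prob \<mu> A - measure_pmf.prob \<nu> A\<bar>)"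

definition stationary :: "'a set \<Rightarrow> ('a \<Rightarrow> 'a pmf) \<Rightarrow> 'a pmf \<Rightarrow> bool" where
  "stationary S K \<pi> \<longleftrightarrow> set_pmf \<pi> \<subseteq> S \<and> bind_pmf \<pi> K = \<pi>"

definition geometrically_ergodic :: "'a set \<Rightarrow> ('a \<Rightarrow> 'a pmf) \<Rightarrow> bool" where
  "geometrically_ergodic S K \<longleftrightarrow>
     (\<exists>\<pi>. stationary S K \<pi> \<and>
       (\<exists>\<rho>. 0 < \<rho> \<and> \<rho> < 1 \<and>
         (\<forall>x\<in>S. \<exists>C. \<forall>n. tv_dist (kernel_power K n x) \<pi> \<le> C * \<rho> ^ n)))"

end

(* The proof is Harris' theorem in the dual form of Hairer and Mattingly.  Let V satisfy the drift
   condition P V <= g V + L with g < 1, and let the N-step kernel charge a fixed state z with mass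
   bounded below on each sublevel set of V.  For small b > 0, P^N then contracts by a factor < 1 the
   seminorm of f given by the least M with |f - c| <= M (1 + b V) for some constant c.  Applied to
   f(x) = P^n(x, A), this bounds |P^n(x, A) - P^n(y, A)| exponentially, uniformly in A, so the laws
   P^n(z, .) are Cauchy in total variation; their limit is the stationary law.

   For the Hawkes chain, V(x) = b_1 x_1 + ... + b_p x_p with b_i the sum of (a_j)_+ + e over
   j = i, ..., p, where e makes b_1 = 1.  Since (a_i)_+ + b_{i+1} = b_i - e <= (1 - e) b_i, the drift
   condition holds.  The state 0 is reached by p consecutive zero transitions, along which V does not
   increase. *)

theory Submission
  imports Defs
begin

section \<open>Integrals against discrete laws and contraction in a weighted seminorm\<close>

lemma integrable_pmf_bounded:
  fixes g :: "'a \<Rightarrow> real"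
  assumes "\<And>x. \<bar>g x\<bar> \<le> B"
  shows "integrable (measure_pmf q) g"
  by (rule measure_pmf.integrable_const_bound[where B = B]) (use assms in auto)

lemma integral_pmf_ge_point:
  fixes h :: "'a \<Rightarrow> real"
  assumes "integrable (measure_pmf q) h" "\<And>x. x \<in> set_pmf q \<Longrightarrow> 0 \<le> h x"
  shows "pmf q z * h z \<le> (\<integral>x. h x \<partial>q)"
proof -
  have "pmf q z * h z = (\<integral>x. indicator {z} x * h z \<partial>q)"
    by (simp add: measure_pmf_single)
  also have "\<dots> \<le> (\<integral>x. h x \<partial>q)"
  proof (rule integral_mono_AE)
    show "integrable (measure_pmf q) (\<lambda>x. indicator {z} x * h z)"
      by (rule integrable_pmf_bounded[where B = "\<bar>h z\<bar>"]) (simp add: indicator_def)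
    show "AE x in measure_pmf q. indicator {z} x * h z \<le> h x"
      using assms(2) by (auto simp: AE_measure_pmf_iff indicator_def)
  qed fact
  finally show ?thesis .
qed

text \<open>Splitting mass \<open>c\<close> off at \<open>z\<close> leaves mass
  \<open>1 - c\<close>, whence the factor of \<open>a\<close>. The function
  \<open>a + b * V x - g x\<close> is nonnegative on the support, so its integral is at least
  \<open>c\<close> times its value at \<open>z\<close>; outside the support \<open>c\<close> is
  forced to be 0. The leftover term \<open>c * b * V z\<close> has the right sign and is
  dropped.\<close>

lemma integral_pmf_minus_atom_le:
  fixes g V :: "'a \<Rightarrow> real" and q :: "'a pmf"
  assumes V: "\<And>x. 0 \<le> V x"
    and W: "(\<integral>\<^sup>+x. ennreal (V x) \<partial>q) \<le> ennreal W" "0 \<le> W"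
    and g: "\<And>x. \<bar>g x\<bar> \<le> B" "\<And>x. x \<in> set_pmf q \<Longrightarrow> g x \<le> a + b * V x"
    and c: "0 \<le> c" "c \<le> pmf q z" and "0 \<le> b"
  shows "(\<integral>x. g x \<partial>q) - c * g z \<le> (1 - c) * a + b * W"
proof -
  have intV: "integrable (measure_pmf q) V"
    by (rule integrableI_nonneg) (use V W in \<open>auto simp: top.not_eq_extremum intro: le_less_trans\<close>)
  have "ennreal (\<integral>x. V x \<partial>q) = (\<integral>\<^sup>+x. ennreal (V x) \<partial>q)"
    by (rule nn_integral_eq_integral[symmetric]) (use intV V in auto)
  with W have V_le: "(\<integral>x. V x \<partial>q) \<le> W"
    by (metis ennreal_le_iff)
  have intg: "integrable (measure_pmf q) g"
    by (rule integrable_pmf_bounded) (rule g)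
  let ?h = "\<lambda>x. (a + b * V x) - g x"
  have inth: "integrable (measure_pmf q) ?h"
    using intV intg by auto
  have "c * ?h z \<le> pmf q z * ?h z"
  proof (cases "z \<in> set_pmf q")
    case True
    then show ?thesis using c g(2)[of z] by (intro mult_right_mono) auto
  next
    case False
    then show ?thesis using c by (simp add: set_pmf_iff)
  qed
  also have "\<dots> \<le> (\<integral>x. ?h x \<partial>q)"
    by (rule integral_pmf_ge_point[OF inth]) (use g in auto)
  also have "\<dots> = a + b * (\<integral>x. V x \<partial>q) - (\<integral>x. g x \<partial>q)"
    using intV intg by simp
  also have "\<dots> \<le> a + b * W - (\<integral>x. g x \<partial>q)"
    using V_le \<open>0 \<le> b\<close> by (simp add: mult_left_mono)
  finally have "c * ?h z \<le> a + b * W - (\<integral>x. g x \<partial>q)" .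
  moreover have "0 \<le> c * (b * V z)"
    using c \<open>0 \<le> b\<close> V[of z] by simp
  ultimately show ?thesis
    by (simp add: algebra_simps)
qed

text \<open>The hypothesis says that the intervals with midpoint \<open>h x\<close> and radius
  \<open>w x\<close> meet pairwise. Helly's theorem on the line then gives a common point, here the
  supremum of the left endpoints. This turns a bound on differences into a bound around one
  constant.\<close>

lemma weighted_centre_exists:
  fixes h w :: "'a \<Rightarrow> real"
  assumes "\<And>x y. x \<in> S \<Longrightarrow> y \<in> S \<Longrightarrow> \<bar>h x - h y\<bar> \<le> w x + w y"
  shows "\<exists>c. \<forall>x\<in>S. \<bar>h x - c\<bar> \<le> w x"
proof (cases "S = {}")
  case False
  then obtain x0 where x0: "x0 \<in> S" by auto
  define c where "c = (SUP y\<in>S. h y - w y)"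
  have le: "h y - w y \<le> h x + w x" if "x \<in> S" "y \<in> S" for x y
    using assms[OF that] by linarith
  have bdd: "bdd_above ((\<lambda>y. h y - w y) ` S)"
    using le[OF x0] by (auto intro!: bdd_aboveI2)
  have "\<bar>h x - c\<bar> \<le> w x" if "x \<in> S" for x
  proof -
    have "h x - w x \<le> c"
      unfolding c_def by (rule cSUP_upper[OF that bdd])
    moreover have "c \<le> h x + w x"
      unfolding c_def using False le that by (intro cSUP_least) auto
    ultimately show ?thesis by linarith
  qed
  then show ?thesis by auto
qed simp

text \<open>For \<open>V x + V y <= R\<close> both laws charge \<open>z\<close>, and the common mass
  \<open>c\<close> cancels in the difference; beyond \<open>R\<close> the drift alone gains. The
  first lower bound on \<kappa> serves the first case, the third serves the second case, and
  \<open>g <= \<kappa>\<close> serves both.\<close>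

lemma weighted_contraction:
  fixes Q :: "'a \<Rightarrow> 'a pmf" and V f :: "'a \<Rightarrow> real"
  assumes closed: "\<And>x. x \<in> S \<Longrightarrow> set_pmf (Q x) \<subseteq> S"
    and V: "\<And>x. 0 \<le> V x"
    and drift: "\<And>x. x \<in> S \<Longrightarrow> (\<integral>\<^sup>+y. ennreal (V y) \<partial>Q x) \<le> ennreal (g * V x + L)"
    and minor: "\<And>x. x \<in> S \<Longrightarrow> V x \<le> R \<Longrightarrow> c \<le> pmf (Q x) z"
    and g: "0 \<le> g" and L: "0 \<le> L" and c: "0 < c" and \<beta>: "0 < \<beta>" "2 * \<beta> * L \<le> c"
    and R: "2 * L + 1 \<le> (1 - g) * R" "0 < R"
    and \<kappa>: "1 - c / 2 \<le> \<kappa>" "g \<le> \<kappa>" "1 - \<beta> / (2 + \<beta> * R) \<le> \<kappa>"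
    and f: "\<And>x. \<bar>f x\<bar> \<le> B" "\<And>x. x \<in> S \<Longrightarrow> \<bar>f x - c0\<bar> \<le> M * (1 + \<beta> * V x)" and "0 \<le> M"
  shows "\<exists>c1. \<forall>x\<in>S. \<bar>(\<integral>y. f y \<partial>Q x) - c1\<bar> \<le> (\<kappa> * M) * (1 + \<beta> * V x)"
proof (rule weighted_centre_exists)
  \<comment> \<open>Here \<open>d\<close> is the mass removed at \<open>z\<close>; it will be
    \<open>c\<close> when both points are low and 0 otherwise.\<close>
  have one_sided:
    "(\<integral>y. f y \<partial>Q x) - c0 - d * (f z - c0) \<le> M * (1 - d + \<beta> * (g * V x + L))"
    "c0 - (\<integral>y. f y \<partial>Q x) - d * (c0 - f z) \<le> M * (1 - d + \<beta> * (g * V x + L))"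
    if "x \<in> S" "0 \<le> d" "d \<le> pmf (Q x) z" for x d
  proof -
    have W: "0 \<le> g * V x + L" using g L V[of x] by simp
    have intf: "integrable (measure_pmf (Q x)) f"
      by (rule integrable_pmf_bounded) (rule f)
    have bd: "\<bar>f y - c0\<bar> \<le> B + \<bar>c0\<bar>" "\<bar>c0 - f y\<bar> \<le> B + \<bar>c0\<bar>" for y
      using f(1)[of y] by linarith+
    have le: "f y - c0 \<le> M + M * \<beta> * V y" "c0 - f y \<le> M + M * \<beta> * V y"
      if "y \<in> set_pmf (Q x)" for y
      using f(2)[of y] closed[OF \<open>x \<in> S\<close>] that by (auto simp: algebra_simps)
    have nn: "0 \<le> M * \<beta>" using \<open>0 \<le> M\<close> \<beta> by simp
    have "(\<integral>y. f y - c0 \<partial>Q x) - d * (f z - c0) \<le> (1 - d) * M + M * \<beta> * (g * V x + L)"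
      by (rule integral_pmf_minus_atom_le[where V = V and B = "B + \<bar>c0\<bar>"])
         (use V drift that W bd le nn in auto)
    then show "(\<integral>y. f y \<partial>Q x) - c0 - d * (f z - c0) \<le> M * (1 - d + \<beta> * (g * V x + L))"
      using intf by (simp add: algebra_simps)
    have "(\<integral>y. c0 - f y \<partial>Q x) - d * (c0 - f z) \<le> (1 - d) * M + M * \<beta> * (g * V x + L)"
      by (rule integral_pmf_minus_atom_le[where V = V and B = "B + \<bar>c0\<bar>"])
         (use V drift that W bd le nn in auto)
    then show "c0 - (\<integral>y. f y \<partial>Q x) - d * (c0 - f z) \<le> M * (1 - d + \<beta> * (g * V x + L))"
      using intf by (simp add: algebra_simps)
  qed
  fix x y assume xy: "x \<in> S" "y \<in> S"
  define s where "s = V x + V y"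
  have s: "0 \<le> s" using V[of x] V[of y] by (simp add: s_def)
  \<comment> \<open>Adding the upper bound at one point to the lower bound at the other cancels both
    \<open>c0\<close> and the atom term \<open>d * (f z - c0)\<close>.\<close>
  have diff: "\<bar>(\<integral>u. f u \<partial>Q x) - (\<integral>u. f u \<partial>Q y)\<bar> \<le> M * (2 - 2 * d + \<beta> * (g * s + 2 * L))"
    if "0 \<le> d" "d \<le> pmf (Q x) z" "d \<le> pmf (Q y) z" for d
    using one_sided[OF xy(1) that(1,2)] one_sided[OF xy(2) that(1,3)]
    by (simp add: s_def algebra_simps)
  have "\<bar>(\<integral>u. f u \<partial>Q x) - (\<integral>u. f u \<partial>Q y)\<bar> \<le> M * (\<kappa> * (2 + \<beta> * s))"
  proof (cases "s \<le> R")
    case True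
    then have "c \<le> pmf (Q x) z" "c \<le> pmf (Q y) z"
      using minor xy V[of x] V[of y] by (auto simp: s_def)
    then have "\<bar>(\<integral>u. f u \<partial>Q x) - (\<integral>u. f u \<partial>Q y)\<bar> \<le> M * (2 - 2 * c + \<beta> * (g * s + 2 * L))"
      using diff c by simp
    also have "\<dots> \<le> M * (\<kappa> * (2 + \<beta> * s))"
    proof (rule mult_left_mono)
      have "g * (\<beta> * s) \<le> \<kappa> * (\<beta> * s)"
        using \<kappa>(2) s \<beta> by (intro mult_right_mono) auto
      with \<kappa>(1) \<beta>(2) show "2 - 2 * c + \<beta> * (g * s + 2 * L) \<le> \<kappa> * (2 + \<beta> * s)"
        by (simp add: algebra_simps)
    qed fact
    finally show ?thesis .
  next
    case False
    have "\<bar>(\<integral>u. f u \<partial>Q x) - (\<integral>u. f u \<partial>Q y)\<bar> \<le> M * (2 + \<beta> * (g * s + 2 * L))"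
      using diff[of 0] by simp
    also have "\<dots> \<le> M * (\<kappa> * (2 + \<beta> * s))"
    proof (rule mult_left_mono)
      \<comment> \<open>Both sides of the goal are affine in \<open>s\<close>. Facts 1 and 3 settle
        it at \<open>s = R\<close>; fact 2 compares the slopes on the excess
        \<open>s - R\<close>.\<close>
      have pos: "0 < 2 + \<beta> * R" using \<beta> R by (simp add: add_pos_pos)
      have "(1 - \<beta> / (2 + \<beta> * R)) * (2 + \<beta> * R) \<le> \<kappa> * (2 + \<beta> * R)"
        using \<kappa>(3) pos by (intro mult_right_mono) auto
      then have 1: "2 + \<beta> * R - \<beta> \<le> \<kappa> * (2 + \<beta> * R)"
        using pos by (simp add: left_diff_distrib)
      have 2: "g * (\<beta> * (s - R)) \<le> \<kappa> * (\<beta> * (s - R))"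
        using \<kappa>(2) False \<beta> by (intro mult_right_mono) auto
      have 3: "\<beta> * (2 * L + 1) \<le> \<beta> * ((1 - g) * R)"
        using R \<beta> by (intro mult_left_mono) auto
      from 1 2 3 show "2 + \<beta> * (g * s + 2 * L) \<le> \<kappa> * (2 + \<beta> * s)"
        by (simp add: algebra_simps)
    qed fact
    finally show ?thesis .
  qed
  then show "\<bar>(\<integral>u. f u \<partial>Q x) - (\<integral>u. f u \<partial>Q y)\<bar>
      \<le> (\<kappa> * M) * (1 + \<beta> * V x) + (\<kappa> * M) * (1 + \<beta> * V y)"
    by (simp add: s_def algebra_simps)
qed

section \<open>Limits of discrete laws\<close>

lemma exists_finite_prob_gt:
  assumes "e > 0"
  shows "\<exists>F. finite F \<and> measure_pmf.prob q F > 1 - e"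
proof -
  \<comment> \<open>The support is countable, so the initial segments of an enumeration exhaust it
    by finite sets, and continuity from below applies.\<close>
  let ?F = "\<lambda>n. from_nat_into (set_pmf q) ` {..n}"
  have "(\<Union>n. ?F n) = range (from_nat_into (set_pmf q))"
    by auto
  then have U: "(\<Union>n. ?F n) = set_pmf q"
    by (simp add: range_from_nat_into set_pmf_not_empty)
  have "(\<lambda>n. measure_pmf.prob q (?F n)) \<longlonglongrightarrow> measure_pmf.prob q (\<Union>n. ?F n)"
    by (rule measure_pmf.finite_Lim_measure_incseq) (auto simp: incseq_def)
  then have "(\<lambda>n. measure_pmf.prob q (?F n)) \<longlonglongrightarrow> 1"
    using measure_pmf.prob_eq_1[of "set_pmf q" q] AE_measure_pmf[of q] unfolding U by simp
  then have "eventually (\<lambda>n. measure_pmf.prob q (?F n) > 1 - e) sequentially"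
    using assms by (intro order_tendstoD) auto
  then obtain n where "measure_pmf.prob q (?F n) > 1 - e"
    by (auto simp: eventually_sequentially)
  then show ?thesis by blast
qed

text \<open>Setwise limits are only finitely additive in general, since mass may escape to infinity.
  The bound \<open>e n\<close>, uniform in \<open>A\<close>, prevents this: a finite set carrying
  most of one \<mu> n still carries most of the limit.\<close>

lemma uniform_setwise_limit_pmf:
  fixes \<mu> :: "nat \<Rightarrow> 'a pmf"
  assumes cauchy: "\<And>A m n. \<bar>measure_pmf.prob (\<mu> (m + n)) A - measure_pmf.prob (\<mu> n) A\<bar> \<le> e n"
    and e: "e \<longlonglongrightarrow> 0"
  shows "\<exists>\<pi>. \<forall>A. (\<lambda>n. measure_pmf.prob (\<mu> n) A) \<longlonglongrightarrow> measure_pmf.prob \<pi> A"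
proof -
  have "Cauchy (\<lambda>n. measure_pmf.prob (\<mu> n) A)" for A
  proof (rule metric_CauchyI)
    fix d :: real assume "0 < d"
    with e have "eventually (\<lambda>n. e n < d / 2) sequentially"
      by (intro order_tendstoD) auto
    then obtain N where N: "e N < d / 2"
      by (auto simp: eventually_sequentially)
    have *: "\<bar>measure_pmf.prob (\<mu> n) A - measure_pmf.prob (\<mu> N) A\<bar> < d / 2" if "n \<ge> N" for n
      using cauchy[of "n - N" N A] that N by simp
    show "\<exists>M. \<forall>m\<ge>M. \<forall>n\<ge>M. dist (measure_pmf.prob (\<mu> m) A) (measure_pmf.prob (\<mu> n) A) < d"
    proof (intro exI[of _ N] allI impI)
      fix m n assume "N \<le> m" "N \<le> n"
      with *[of m] *[of n] show "dist (measure_pmf.prob (\<mu> m) A) (measure_pmf.prob (\<mu> n) A) < d"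
        unfolding dist_real_def by linarith
    qed
  qed
  then have "\<forall>A. \<exists>l. (\<lambda>n. measure_pmf.prob (\<mu> n) A) \<longlonglongrightarrow> l"
    by (meson Cauchy_convergent convergentD)
  then obtain l where l: "\<And>A. (\<lambda>n. measure_pmf.prob (\<mu> n) A) \<longlonglongrightarrow> l A"
    by metis
  have l_close: "\<bar>l A - measure_pmf.prob (\<mu> n) A\<bar> \<le> e n" for A n
  proof (rule LIMSEQ_le_const2)
    show "(\<lambda>m. \<bar>measure_pmf.prob (\<mu> (m + n)) A - measure_pmf.prob (\<mu> n) A\<bar>)
        \<longlonglongrightarrow> \<bar>l A - measure_pmf.prob (\<mu> n) A\<bar>"
      by (intro tendsto_intros LIMSEQ_ignore_initial_segment l)
  qed (use cauchy in auto)
  have l_nonneg: "0 \<le> l A" for A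
    by (rule LIMSEQ_le_const[OF l]) auto
  have l_mono: "l A \<le> l B" if "A \<subseteq> B" for A B
    using that by (intro LIMSEQ_le[OF l l]) (auto intro!: measure_pmf.finite_measure_mono)
  have l_compl: "l (- A) = 1 - l A" for A
  proof (rule LIMSEQ_unique[OF l])
    have "measure_pmf.prob (\<mu> n) (- A) = 1 - measure_pmf.prob (\<mu> n) A" for n
      using measure_pmf.prob_compl[of A "\<mu> n"] by (simp add: Compl_eq_Diff_UNIV)
    then show "(\<lambda>n. measure_pmf.prob (\<mu> n) (- A)) \<longlonglongrightarrow> 1 - l A"
      using l[of A] by (auto intro!: tendsto_intros)
  qed
  define f where "f x = l {x}" for x
  have l_finite: "l F = sum f F" if "finite F" for F
  proof (rule LIMSEQ_unique[OF l])
    show "(\<lambda>n. measure_pmf.prob (\<mu> n) F) \<longlonglongrightarrow> sum f F"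
      unfolding f_def measure_measure_pmf_finite[OF that]
      using l[of "{_}"] by (intro tendsto_sum) (simp add: measure_pmf_single)
  qed
  have f_lim: "(\<lambda>n. pmf (\<mu> n) x) \<longlonglongrightarrow> f x" for x
    using l[of "{x}"] by (simp add: f_def measure_pmf_single)
  \<comment> \<open>Fatou's lemma bounds the total mass of the point limits by 1.\<close>
  have "(\<integral>\<^sup>+x. ennreal (f x) \<partial>count_space UNIV)
      = (\<integral>\<^sup>+x. liminf (\<lambda>n. ennreal (pmf (\<mu> n) x)) \<partial>count_space UNIV)"
    using f_lim by (intro nn_integral_cong lim_imp_Liminf[symmetric]) auto
  also have "\<dots> \<le> liminf (\<lambda>n. \<integral>\<^sup>+x. ennreal (pmf (\<mu> n) x) \<partial>count_space UNIV)"
    by (rule nn_integral_liminf) auto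
  also have "\<dots> = 1"
    by (simp add: nn_integral_pmf Liminf_const)
  finally have upper: "(\<integral>\<^sup>+x. ennreal (f x) \<partial>count_space UNIV) \<le> 1" .
  \<comment> \<open>No mass is lost: a finite \<open>F\<close> nearly full for \<mu> N loses at most
    \<open>e N\<close> in the limit.\<close>
  have lower: "ennreal 1 \<le> (\<integral>\<^sup>+x. ennreal (f x) \<partial>count_space UNIV) + ennreal d" if d: "d > 0" for d :: real
  proof -
    have "eventually (\<lambda>n. e n < d / 2) sequentially"
      using e d by (intro order_tendstoD) auto
    then obtain N where N: "e N < d / 2"
      by (auto simp: eventually_sequentially)
    obtain F where F: "finite F" "measure_pmf.prob (\<mu> N) F > 1 - d / 2"
      using exists_finite_prob_gt[of "d / 2" "\<mu> N"] d by auto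
    have "1 - d \<le> sum f F"
      using l_close[of F N] F N by (simp add: l_finite)
    then have "ennreal 1 \<le> ennreal (sum f F) + ennreal d"
      using d by (subst ennreal_plus[symmetric])
        (auto intro!: ennreal_leI sum_nonneg simp: f_def l_nonneg)
    also have "ennreal (sum f F) = (\<integral>\<^sup>+x. ennreal (f x) \<partial>count_space F)"
      by (simp add: nn_integral_count_space_finite F f_def l_nonneg)
    also have "\<dots> \<le> (\<integral>\<^sup>+x. ennreal (f x) \<partial>count_space UNIV)"
      by (subst nn_integral_count_space_indicator)
         (auto intro!: nn_integral_mono simp: indicator_def)
    finally show ?thesis by simp
  qed
  have total: "(\<integral>\<^sup>+x. ennreal (f x) \<partial>count_space UNIV) = 1"
  proof (rule antisym[OF upper])
    show "1 \<le> (\<integral>\<^sup>+x. ennreal (f x) \<partial>count_space UNIV)"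
      by (rule ennreal_le_epsilon) (use lower in auto)
  qed
  define \<pi> where "\<pi> = embed_pmf f"
  have pmf_\<pi>: "pmf \<pi> x = f x" for x
    unfolding \<pi>_def using total by (intro pmf_embed_pmf) (auto simp: f_def l_nonneg)
  \<comment> \<open>The two set functions agree on finite sets, so cutting \<open>A\<close> with a
    finite set nearly full for \<pi> gives one inequality. Applied to the complement of
    \<open>A\<close>, it gives the other.\<close>
  have \<pi>_le: "measure_pmf.prob \<pi> A \<le> l A" for A
  proof (rule field_le_epsilon)
    fix d :: real assume "0 < d"
    then obtain F where F: "finite F" "measure_pmf.prob \<pi> F > 1 - d"
      using exists_finite_prob_gt by metis
    have "measure_pmf.prob \<pi> A \<le> measure_pmf.prob \<pi> (A \<inter> F \<union> (- F))"
      by (rule measure_pmf.finite_measure_mono) auto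
    also have "\<dots> \<le> measure_pmf.prob \<pi> (A \<inter> F) + measure_pmf.prob \<pi> (- F)"
      by (rule measure_Un_le) auto
    also have "measure_pmf.prob \<pi> (- F) = 1 - measure_pmf.prob \<pi> F"
      using measure_pmf.prob_compl[of F \<pi>] by (simp add: Compl_eq_Diff_UNIV)
    also have "measure_pmf.prob \<pi> (A \<inter> F) = l (A \<inter> F)"
      using F by (simp add: measure_measure_pmf_finite l_finite pmf_\<pi>)
    also have "l (A \<inter> F) \<le> l A"
      by (rule l_mono) auto
    finally show "measure_pmf.prob \<pi> A \<le> l A + d"
      using F by linarith
  qed
  have "measure_pmf.prob \<pi> A = l A" for A
  proof -
    have "measure_pmf.prob \<pi> (- A) = 1 - measure_pmf.prob \<pi> A"
      using measure_pmf.prob_compl[of A \<pi>] by (simp add: Compl_eq_Diff_UNIV)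
    then show ?thesis using \<pi>_le[of A] \<pi>_le[of "- A"] l_compl[of A] by linarith
  qed
  then show ?thesis by (intro exI[of _ \<pi>]) (simp add: l)
qed

text \<open>Fatou's lemma yields only that the law after one more step is pointwise at most \<pi>.
  Both have total mass 1, so they coincide.\<close>

lemma stationary_of_setwise_limit:
  assumes "\<And>A. (\<lambda>n. measure_pmf.prob (\<mu> n) A) \<longlonglongrightarrow> measure_pmf.prob \<pi> A"
    and "\<And>n. \<mu> (Suc n) = bind_pmf (\<mu> n) K"
  shows "bind_pmf \<pi> K = \<pi>"
proof -
  have lim: "(\<lambda>n. pmf (\<mu> n) x) \<longlonglongrightarrow> pmf \<pi> x" for x
    using assms(1)[of "{x}"] by (simp add: measure_pmf_single)
  have "pmf (bind_pmf \<pi> K) z \<le> pmf \<pi> z" for z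
  proof -
    have lim2: "(\<lambda>n. ennreal (pmf (\<mu> n) y) * ennreal (pmf (K y) z))
        \<longlonglongrightarrow> ennreal (pmf \<pi> y) * ennreal (pmf (K y) z)" for y
      unfolding ennreal_mult[OF pmf_nonneg pmf_nonneg, symmetric]
      by (intro tendsto_ennrealI tendsto_intros lim)
    have "ennreal (pmf (bind_pmf \<pi> K) z)
        = (\<integral>\<^sup>+y. liminf (\<lambda>n. ennreal (pmf (\<mu> n) y) * ennreal (pmf (K y) z)) \<partial>count_space UNIV)"
      unfolding ennreal_pmf_bind nn_integral_measure_pmf
      by (intro nn_integral_cong lim_imp_Liminf[symmetric] lim2) auto
    also have "\<dots> \<le> liminf (\<lambda>n. \<integral>\<^sup>+y. ennreal (pmf (\<mu> n) y) * ennreal (pmf (K y) z) \<partial>count_space UNIV)"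
      by (rule nn_integral_liminf) auto
    also have "\<dots> = liminf (\<lambda>n. ennreal (pmf (\<mu> (Suc n)) z))"
      unfolding assms(2) ennreal_pmf_bind nn_integral_measure_pmf ..
    also have "\<dots> = ennreal (pmf \<pi> z)"
      by (intro lim_imp_Liminf tendsto_ennrealI LIMSEQ_Suc lim) auto
    finally show ?thesis by simp
  qed
  then show ?thesis
    using pmf_neq_exists_less[of \<pi> "bind_pmf \<pi> K"] by (metis not_less)
qed

section \<open>Powers of a kernel and Harris' theorem\<close>

lemma kernel_power_add:
  "kernel_power K (m + n) x = bind_pmf (kernel_power K m x) (kernel_power K n)"
  by (induction n) (simp_all add: bind_assoc_pmf bind_return_pmf')

lemma set_kernel_power:
  assumes "\<And>x. x \<in> S \<Longrightarrow> set_pmf (K x) \<subseteq> S" "x \<in> S"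
  shows "set_pmf (kernel_power K n x) \<subseteq> S"
  using assms by (induction n) auto

lemma prob_bind_pmf:
  "measure_pmf.prob (bind_pmf q K) A = (\<integral>y. measure_pmf.prob (K y) A \<partial>q)"
proof -
  have "ennreal (measure_pmf.prob (bind_pmf q K) A) = (\<integral>\<^sup>+y. ennreal (measure_pmf.prob (K y) A) \<partial>q)"
    using emeasure_bind_pmf[of q K A] by (simp add: measure_pmf.emeasure_eq_measure)
  also have "\<dots> = ennreal (\<integral>y. measure_pmf.prob (K y) A \<partial>q)"
    by (intro nn_integral_eq_integral integrable_pmf_bounded[where B = 1]) auto
  finally show ?thesis
    by (subst (asm) ennreal_inj) (auto intro!: Bochner_Integration.integral_nonneg)
qed

text \<open>\<open>L / (1 - g)\<close> is the fixed point of the map sending \<open>t\<close> to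
  \<open>g * t + L\<close>, so the additive constant does not grow with \<open>n\<close>.\<close>

lemma kernel_power_drift:
  fixes V :: "'a \<Rightarrow> real"
  assumes closed: "\<And>x. x \<in> S \<Longrightarrow> set_pmf (K x) \<subseteq> S"
    and V: "\<And>x. 0 \<le> V x"
    and drift: "\<And>x. x \<in> S \<Longrightarrow> (\<integral>\<^sup>+y. ennreal (V y) \<partial>K x) \<le> ennreal (g * V x + L)"
    and g: "0 \<le> g" "g < 1" and L: "0 \<le> L" and x: "x \<in> S"
  shows "(\<integral>\<^sup>+y. ennreal (V y) \<partial>kernel_power K n x) \<le> ennreal (g ^ n * V x + L / (1 - g))"
proof (induction n)
  case 0
  show ?case using V g L by (auto intro!: ennreal_leI)
next
  case (Suc n)
  have "(\<integral>\<^sup>+y. ennreal (V y) \<partial>kernel_power K (Suc n) x)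
      = (\<integral>\<^sup>+u. (\<integral>\<^sup>+y. ennreal (V y) \<partial>K u) \<partial>kernel_power K n x)"
    by simp
  also have "\<dots> \<le> (\<integral>\<^sup>+u. ennreal g * ennreal (V u) + ennreal L \<partial>kernel_power K n x)"
  proof (rule nn_integral_mono_AE, unfold AE_measure_pmf_iff, rule ballI)
    fix u assume "u \<in> set_pmf (kernel_power K n x)"
    then have "u \<in> S" using set_kernel_power[of S K x n] closed x by auto
    from drift[OF this] show "(\<integral>\<^sup>+y. ennreal (V y) \<partial>K u) \<le> ennreal g * ennreal (V u) + ennreal L"
      using g L V by (simp add: ennreal_mult ennreal_plus)
  qed
  also have "\<dots> = ennreal g * (\<integral>\<^sup>+u. ennreal (V u) \<partial>kernel_power K n x) + ennreal L"
    by (simp add: nn_integral_add nn_integral_cmult)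
  also have "\<dots> \<le> ennreal g * ennreal (g ^ n * V x + L / (1 - g)) + ennreal L"
    by (intro add_right_mono mult_left_mono Suc) auto
  also have "\<dots> = ennreal (g * (g ^ n * V x + L / (1 - g)) + L)"
    using g L V by (simp add: ennreal_mult ennreal_plus)
  also have "g * (g ^ n * V x + L / (1 - g)) + L = g ^ Suc n * V x + L / (1 - g)"
    using g by (simp add: field_simps)
  finally show ?case .
qed

text \<open>The drift concerns one step, the minorisation \<open>N\<close> steps.
  \<open>kernel_power_drift\<close> carries the drift over to \<open>N\<close> steps, so
  \<open>weighted_contraction\<close> applies to the \<open>N\<close>-step kernel; the incomplete
  blocks of steps cost only a constant factor.\<close>

theorem harris_atom:
  fixes K :: "'a \<Rightarrow> 'a pmf" and V :: "'a \<Rightarrow> real"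
  assumes closed: "\<And>x. x \<in> S \<Longrightarrow> set_pmf (K x) \<subseteq> S"
    and V: "\<And>x. 0 \<le> V x"
    and drift: "\<And>x. x \<in> S \<Longrightarrow> (\<integral>\<^sup>+y. ennreal (V y) \<partial>K x) \<le> ennreal (g * V x + L)"
    and g: "0 \<le> g" "g < 1" and L: "0 \<le> L"
    and minor: "\<And>R. \<exists>c>0. \<forall>x\<in>S. V x \<le> R \<longrightarrow> c \<le> pmf (kernel_power K N x) z"
    and N: "N \<ge> 1" and z: "z \<in> S"
  shows "geometrically_ergodic S K"
proof -
  define L' where "L' = L / (1 - g)"
  have L': "0 \<le> L'" using L g by (simp add: L'_def)
  have drift_n: "(\<integral>\<^sup>+y. ennreal (V y) \<partial>kernel_power K n x) \<le> ennreal (g ^ n * V x + L')"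
    if "x \<in> S" for n x
    unfolding L'_def by (rule kernel_power_drift[where S = S]) (use assms that in auto)
  define R where "R = (2 * L' + 1) / (1 - g)"
  have R: "2 * L' + 1 \<le> (1 - g) * R" "0 < R"
    using L' g by (auto simp: R_def)
  obtain c where c: "0 < c" "\<And>x. x \<in> S \<Longrightarrow> V x \<le> R \<Longrightarrow> c \<le> pmf (kernel_power K N x) z"
    using minor[of R] by auto
  define \<beta> where "\<beta> = c / (2 * L' + 1)"
  have \<beta>: "0 < \<beta>" "2 * \<beta> * L' \<le> c"
    using c L' by (auto simp: \<beta>_def field_simps)
  \<comment> \<open>The first three entries are what \<open>weighted_contraction\<close> demands;
    \<open>1 / 2\<close> makes \<kappa> positive, for the root and the divisions below.\<close>
  define \<kappa> where "\<kappa> = Max {1 - c / 2, g, 1 - \<beta> / (2 + \<beta> * R), 1 / 2}"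
  have "0 < 2 + \<beta> * R" using \<beta> R by (simp add: add_pos_pos)
  then have "\<kappa> < 1"
    unfolding \<kappa>_def using c g \<beta> by simp
  moreover have "1 - c / 2 \<le> \<kappa>" "g \<le> \<kappa>" "1 - \<beta> / (2 + \<beta> * R) \<le> \<kappa>" "1 / 2 \<le> \<kappa>"
    unfolding \<kappa>_def by (rule Max_ge; simp)+
  ultimately have \<kappa>: "1 - c / 2 \<le> \<kappa>" "g \<le> \<kappa>" "1 - \<beta> / (2 + \<beta> * R) \<le> \<kappa>" "1 / 2 \<le> \<kappa>" "\<kappa> < 1"
    by blast+
  define u where "u A n x = measure_pmf.prob (kernel_power K n x) A" for A n x
  have u_add: "u A (m + n) x = (\<integral>y. u A n y \<partial>kernel_power K m x)" for A m n x
    by (simp add: u_def kernel_power_add prob_bind_pmf)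
  have u_bound: "\<bar>u A n x\<bar> \<le> 1" for A n x
    by (simp add: u_def)
  \<comment> \<open>Each block of \<open>N\<close> steps contracts by \<kappa>; \<open>r\<close>
    stands for the steps outside full blocks. The induction starts from centre 0, as probabilities
    are at most 1, and its bound is the same for all \<open>A\<close>.\<close>
  have centre: "\<exists>c0. \<forall>x\<in>S. \<bar>u A (N * q + r) x - c0\<bar> \<le> \<kappa> ^ q * (1 + \<beta> * V x)" for A q r
  proof (induction q)
    case 0
    have "\<bar>u A r x - 0\<bar> \<le> 1 + \<beta> * V x" for x
      using u_bound[of A r x] \<beta> V[of x] by (smt (verit) mult_nonneg_nonneg)
    then show ?case by (intro exI[of _ 0]) simp
  next
    case (Suc q)
    then obtain c0 where c0: "\<And>x. x \<in> S \<Longrightarrow> \<bar>u A (N * q + r) x - c0\<bar> \<le> \<kappa> ^ q * (1 + \<beta> * V x)"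
      by auto
    have "\<exists>c1. \<forall>x\<in>S. \<bar>(\<integral>y. u A (N * q + r) y \<partial>kernel_power K N x) - c1\<bar>
        \<le> (\<kappa> * \<kappa> ^ q) * (1 + \<beta> * V x)"
    proof (rule weighted_contraction[where S = S and g = g and L = L' and R = R and c = c
          and z = z and B = 1 and c0 = c0])
      show "set_pmf (kernel_power K N x) \<subseteq> S" if "x \<in> S" for x
        by (rule set_kernel_power) (use closed that in auto)
      show "(\<integral>\<^sup>+y. ennreal (V y) \<partial>kernel_power K N x) \<le> ennreal (g * V x + L')" if "x \<in> S" for x
      proof -
        have "g ^ N \<le> g ^ 1" using g N by (intro power_decreasing) auto
        then have "g ^ N * V x \<le> g * V x"
          using V[of x] by (intro mult_right_mono) auto
        then show ?thesis
          using drift_n[OF that, of N] by (meson add_right_mono ennreal_leI order_trans)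
      qed
    qed (use V g L' c \<beta> R \<kappa> u_bound c0 in auto)
    then show ?case
      by (simp add: u_add[symmetric] add.assoc)
  qed
  define \<rho> where "\<rho> = root N \<kappa>"
  have \<rho>: "0 < \<rho>" "\<rho> < 1" "\<rho> ^ N = \<kappa>"
    using \<kappa> N by (auto simp: \<rho>_def real_root_pow_pos2)
  \<comment> \<open>Rounding \<open>n\<close> down to a multiple of \<open>N\<close> loses fewer
    than \<open>N\<close> steps, hence at most a factor \<open>1 / \<kappa>\<close>.\<close>
  have \<kappa>_pow: "\<kappa> ^ (n div N) \<le> \<rho> ^ n / \<kappa>" for n
  proof -
    have "n \<le> N * (n div N) + N"
      using N by (metis Suc_le_eq One_nat_def add_le_cancel_left less_imp_le mod_less_divisor mult_div_mod_eq)
    then have "\<rho> ^ (N * (n div N) + N) \<le> \<rho> ^ n"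
      using \<rho> by (intro power_decreasing) auto
    then have "\<kappa> ^ (n div N) * \<kappa> \<le> \<rho> ^ n"
      by (simp add: power_add power_mult \<rho>)
    then show ?thesis using \<kappa> by (simp add: field_simps)
  qed
  have u_diff: "\<bar>u A n x - u A n y\<bar> \<le> \<rho> ^ n / \<kappa> * (2 + \<beta> * V x + \<beta> * V y)"
    if "x \<in> S" "y \<in> S" for A n x y
  proof -
    obtain c0 where "\<And>x. x \<in> S \<Longrightarrow> \<bar>u A n x - c0\<bar> \<le> \<kappa> ^ (n div N) * (1 + \<beta> * V x)"
      using centre[of A "n div N" "n mod N"] by auto
    from this[OF that(1)] this[OF that(2)]
    have "\<bar>u A n x - u A n y\<bar> \<le> \<kappa> ^ (n div N) * (2 + \<beta> * V x + \<beta> * V y)"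
      by (simp add: algebra_simps)
    also have "\<dots> \<le> \<rho> ^ n / \<kappa> * (2 + \<beta> * V x + \<beta> * V y)"
      using \<beta> V[of x] V[of y] by (intro mult_right_mono \<kappa>_pow) auto
    finally show ?thesis .
  qed
  \<comment> \<open>After the first \<open>k\<close> steps from \<open>y\<close>, averaging
    \<open>u_diff\<close> over the position reached needs only the mean of \<open>V\<close> there,
    which is at most \<open>V y + L'\<close> for every \<open>k\<close>.\<close>
  have u_diff_shift: "\<bar>u A (k + n) y - u A n x\<bar> \<le> \<rho> ^ n / \<kappa> * (2 + \<beta> * V x + \<beta> * (V y + L'))"
    if "x \<in> S" "y \<in> S" for A k n x y
  proof -
    let ?q = "kernel_power K k y"
    define D where "D = \<rho> ^ n / \<kappa>"
    have D: "0 \<le> D" using \<rho> \<kappa> by (simp add: D_def)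
    have "(\<integral>\<^sup>+v. ennreal (V v) \<partial>?q) \<le> ennreal (g ^ k * V y + L')"
      by (rule drift_n) fact
    also have "\<dots> \<le> ennreal (V y + L')"
      using V[of y] g by (intro ennreal_leI add_right_mono mult_left_le_one_le power_le_one) auto
    finally have W: "(\<integral>\<^sup>+v. ennreal (V v) \<partial>?q) \<le> ennreal (V y + L')" .
    have bd: "\<bar>u A n v - u A n x\<bar> \<le> D * (2 + \<beta> * V x) + D * \<beta> * V v" if "v \<in> set_pmf ?q" for v
    proof -
      have "v \<in> S" using set_kernel_power[of S K y k] closed \<open>y \<in> S\<close> that by auto
      from u_diff[OF this \<open>x \<in> S\<close>, of A n] show ?thesis
        by (simp add: D_def[symmetric] algebra_simps)
    qed
    have b2: "\<bar>u A n v - u A n x\<bar> \<le> 2" "\<bar>u A n x - u A n v\<bar> \<le> 2" for v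
      using u_bound[of A n v] u_bound[of A n x] by linarith+
    have W0: "0 \<le> V y + L'" using V[of y] L' by simp
    have int: "integrable (measure_pmf ?q) (u A n)"
      by (rule integrable_pmf_bounded) (rule u_bound)
    \<comment> \<open>The removed mass is 0 here, so the atom lemma is just a bound by the mean of
      \<open>V\<close>; the trivial factors match its form.\<close>
    have 1: "(\<integral>v. u A n v - u A n x \<partial>?q) - 0 * (u A n z - u A n x)
        \<le> (1 - 0) * (D * (2 + \<beta> * V x)) + D * \<beta> * (V y + L')"
      by (rule integral_pmf_minus_atom_le[where V = V and B = 2])
         (use V W W0 b2 bd D \<beta> in \<open>auto simp: abs_le_iff\<close>)
    have 2: "(\<integral>v. u A n x - u A n v \<partial>?q) - 0 * (u A n x - u A n z)
        \<le> (1 - 0) * (D * (2 + \<beta> * V x)) + D * \<beta> * (V y + L')"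
      by (rule integral_pmf_minus_atom_le[where V = V and B = 2])
         (use V W W0 b2 bd D \<beta> in \<open>auto simp: abs_le_iff\<close>)
    show ?thesis
      using 1 2 int unfolding D_def[symmetric] u_add by (simp add: algebra_simps abs_le_iff)
  qed
  define \<mu> where "\<mu> n = kernel_power K n z" for n
  define C where "C x = (2 + \<beta> * V x + \<beta> * (V z + L')) / \<kappa>" for x
  \<comment> \<open>Taking \<open>x = z\<close> gives the Cauchy property that produces \<pi>;
    letting \<open>k\<close> tend to infinity for general \<open>x\<close> gives the rate of
    convergence to \<pi>.\<close>
  have close: "\<bar>measure_pmf.prob (\<mu> (k + n)) A - u A n x\<bar> \<le> C x * \<rho> ^ n" if "x \<in> S" for x k n A
    using u_diff_shift[OF that z, of A k n] by (simp add: \<mu>_def u_def C_def mult.commute)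
  have "\<exists>\<pi>. \<forall>A. (\<lambda>n. measure_pmf.prob (\<mu> n) A) \<longlonglongrightarrow> measure_pmf.prob \<pi> A"
  proof (rule uniform_setwise_limit_pmf)
    show "\<bar>measure_pmf.prob (\<mu> (m + n)) A - measure_pmf.prob (\<mu> n) A\<bar> \<le> C z * \<rho> ^ n" for m n A
      using close[OF z, of m n A] by (simp add: u_def \<mu>_def)
    show "(\<lambda>n. C z * \<rho> ^ n) \<longlonglongrightarrow> 0"
      using \<rho> by (intro tendsto_mult_right_zero LIMSEQ_realpow_zero) auto
  qed
  then obtain \<pi> where \<pi>: "\<And>A. (\<lambda>n. measure_pmf.prob (\<mu> n) A) \<longlonglongrightarrow> measure_pmf.prob \<pi> A"
    by auto
  have "bind_pmf \<pi> K = \<pi>"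
    using \<pi> by (rule stationary_of_setwise_limit) (simp add: \<mu>_def)
  moreover have "set_pmf \<pi> \<subseteq> S"
  proof
    fix y assume y: "y \<in> set_pmf \<pi>"
    show "y \<in> S"
    proof (rule ccontr)
      assume "y \<notin> S"
      then have "pmf (\<mu> n) y = 0" for n
        using set_kernel_power[of S K z n] closed z by (auto simp: \<mu>_def set_pmf_iff)
      then have "measure_pmf.prob \<pi> {y} = 0"
        using \<pi>[of "{y}"] by (simp add: measure_pmf_single LIMSEQ_const_iff)
      with y show False by (simp add: measure_pmf_single set_pmf_iff)
    qed
  qed
  moreover have "tv_dist (kernel_power K n x) \<pi> \<le> C x * \<rho> ^ n" if "x \<in> S" for x n
    unfolding tv_dist_def
  proof (rule cSUP_least)
    fix A :: "'a set"
    have "\<bar>measure_pmf.prob \<pi> A - u A n x\<bar> \<le> C x * \<rho> ^ n"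
    proof (rule LIMSEQ_le_const2)
      show "(\<lambda>k. \<bar>measure_pmf.prob (\<mu> (k + n)) A - u A n x\<bar>) \<longlonglongrightarrow> \<bar>measure_pmf.prob \<pi> A - u A n x\<bar>"
        by (intro tendsto_intros LIMSEQ_ignore_initial_segment \<pi>)
    qed (use close[OF that] in auto)
    then show "\<bar>measure_pmf.prob (kernel_power K n x) A - measure_pmf.prob \<pi> A\<bar> \<le> C x * \<rho> ^ n"
      by (simp add: u_def abs_minus_commute)
  qed simp
  ultimately show ?thesis
    unfolding geometrically_ergodic_def stationary_def using \<rho> by blast
qed

section \<open>The Poisson mean and paths of prescribed transitions\<close>

lemma nn_integral_poisson:
  assumes "0 \<le> r"
  shows "(\<integral>\<^sup>+l. ennreal (real l) \<partial>poisson r) = ennreal r"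
proof -
  have s: "(\<lambda>l. exp (- r) * (r ^ l / fact l)) sums (exp (- r) * exp r)"
    using exp_converges[of r] by (intro sums_mult) (simp add: divide_inverse_commute)
  \<comment> \<open>Size-biasing a Poisson law shifts it by one: \<open>l + 1\<close> times the mass
    at \<open>l + 1\<close> is \<open>r\<close> times the mass at \<open>l\<close>.\<close>
  have "(\<lambda>l. pmf (poisson r) (Suc l) * real (Suc l)) = (\<lambda>l. r * (exp (- r) * (r ^ l / fact l)))"
    using assms by (simp add: pmf_poisson_nonneg fun_eq_iff del: of_nat_Suc)
  moreover have "(\<lambda>l. r * (exp (- r) * (r ^ l / fact l))) sums (r * (exp (- r) * exp r))"
    by (intro sums_mult s)
  ultimately have "(\<lambda>l. pmf (poisson r) (Suc l) * real (Suc l)) sums r"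
    by (simp add: exp_minus)
  then have "(\<lambda>l. pmf (poisson r) l * real l) sums r"
    by (subst (asm) sums_Suc_iff) simp
  then have "(\<Sum>l. ennreal (pmf (poisson r) l * real l)) = ennreal r"
    by (intro suminf_ennreal_eq) auto
  then show ?thesis
    by (simp add: nn_integral_measure_pmf nn_integral_count_space_nat ennreal_mult)
qed

lemma pmf_kernel_power_Suc_ge:
  "pmf (kernel_power K n x) y * pmf (K y) v \<le> pmf (kernel_power K (Suc n) x) v"
  unfolding kernel_power.simps pmf_bind
  by (intro integral_pmf_ge_point integrable_pmf_bounded[where B = 1]) (auto simp: pmf_le_1)

text \<open>Of all \<open>n\<close>-step paths only the one that follows \<open>h\<close> is kept.
  The invariant \<open>P\<close> ensures that each of its steps has mass at least
  \<open>c\<close>.\<close>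

lemma kernel_power_path_ge:
  assumes step: "\<And>y. P y \<Longrightarrow> c \<le> pmf (K y) (h y)" "\<And>y. P y \<Longrightarrow> P (h y)"
    and "P x" "0 \<le> c"
  shows "P ((h ^^ n) x) \<and> c ^ n \<le> pmf (kernel_power K n x) ((h ^^ n) x)"
proof (induction n)
  case (Suc n)
  let ?y = "(h ^^ n) x"
  have "c ^ n * c \<le> pmf (kernel_power K n x) ?y * pmf (K ?y) (h ?y)"
    using Suc step \<open>0 \<le> c\<close> by (intro mult_mono) auto
  also have "\<dots> \<le> pmf (kernel_power K (Suc n) x) (h ?y)"
    by (rule pmf_kernel_power_Suc_ge)
  finally show ?case
    using Suc step by (simp add: mult.commute del: kernel_power.simps)
qed (use \<open>P x\<close> in simp)

text \<open>With \<open>n\<close> equal to the length of \<open>x\<close>, every entry has been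
  overwritten and the initial state is forgotten.\<close>

lemma funpow_Cons_butlast:
  "n \<le> length x \<Longrightarrow> ((\<lambda>y. c # butlast y) ^^ n) x = replicate n c @ take (length x - n) x"
proof (induction n)
  case (Suc n)
  then have "take (length x - n) x \<noteq> []" by auto
  with Suc show ?case
    by (simp add: butlast_append butlast_take)
qed simp

section \<open>Linear functions of the state and the Hawkes chain\<close>

definition weighted_size :: "nat \<Rightarrow> (nat \<Rightarrow> real) \<Rightarrow> nat list \<Rightarrow> real" where
  "weighted_size p b x = (\<Sum>i=1..p. b i * real (x ! (i - 1)))"

lemma weighted_size_nonneg:
  assumes "\<And>i. 0 \<le> b i"
  shows "0 \<le> weighted_size p b x"
  unfolding weighted_size_def by (intro sum_nonneg mult_nonneg_nonneg assms) auto

lemma weighted_size_mono: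
  assumes "\<And>i. 1 \<le> i \<Longrightarrow> i \<le> p \<Longrightarrow> b i \<le> b' i"
  shows "weighted_size p b x \<le> weighted_size p b' x"
  unfolding weighted_size_def by (intro sum_mono mult_right_mono assms) auto

text \<open>Moving the entries one place to the right amounts to moving the weights one place to the
  left. The entry lost by \<open>butlast\<close> then has weight \<open>b (Suc p) = 0\<close>, so
  the sum may still run over all of \<open>x\<close>.\<close>

lemma weighted_size_shift:
  assumes "p \<ge> 1" "length x = p" "b (Suc p) = 0"
  shows "weighted_size p b (l # butlast x) = b 1 * real l + weighted_size p (\<lambda>i. b (Suc i)) x"
proof -
  obtain q where q: "p = Suc q" using \<open>p \<ge> 1\<close> by (cases p) auto
  have "(\<Sum>k<q. b (Suc (Suc k)) * real (butlast x ! k)) = (\<Sum>k<q. b (Suc (Suc k)) * real (x ! k))"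
    using assms(2) q by (intro sum.cong) (auto simp: nth_butlast)
  then have "(\<Sum>k<Suc q. b (Suc k) * real ((l # butlast x) ! k))
      = b 1 * real l + (\<Sum>k<Suc q. b (Suc (Suc k)) * real (x ! k))"
    using assms(3) q by (subst sum.lessThan_Suc_shift) simp
  then show ?thesis
    unfolding weighted_size_def One_nat_def sum.atLeast1_atMost_eq q by simp
qed

theorem theorem2p1:
  fixes p :: nat and a :: "nat \<Rightarrow> real" and lam :: real
  assumes "p \<ge> 1"
    and "lam > 0"
    and "(\<Sum>i=1..p. max 0 (a i)) < 1"
  shows "geometrically_ergodic (hawkes_states p) (hawkes_kernel p a lam)"
proof -
  let ?K = "hawkes_kernel p a lam" and ?s = "hawkes_intensity p a lam"
  define e where "e = (1 - (\<Sum>i=1..p. max 0 (a i))) / p"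
  define b where "b i = (\<Sum>j=i..p. max 0 (a j) + e)" for i
  define V where "V = weighted_size p b"
  have e: "0 < e" using assms by (simp add: e_def)
  \<comment> \<open>This makes the drift rate \<open>1 - e\<close> nonnegative, as
    \<open>harris_atom\<close> requires.\<close>
  have e1: "e \<le> 1"
  proof -
    have "0 \<le> (\<Sum>i=1..p. max 0 (a i))" by (intro sum_nonneg) auto
    then show ?thesis using assms(1) by (simp add: e_def field_simps)
  qed
  have b_nonneg: "0 \<le> b i" for i
    unfolding b_def using e by (intro sum_nonneg) auto
  have b_end: "b (Suc p) = 0" by (simp add: b_def)
  have b_start: "b 1 = 1"
    using assms(1) by (simp add: b_def sum.distrib e_def)
  have b_step: "b i = max 0 (a i) + e + b (Suc i)" if "i \<le> p" for i
    using that by (simp add: b_def sum.atLeast_Suc_atMost)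
  have b_ge: "max 0 (a i) \<le> b i" "b (Suc i) \<le> b i" if "i \<le> p" for i
    using b_step[OF that] b_nonneg[of "Suc i"] e by linarith+
  have b_le: "b i \<le> 1" if "1 \<le> i" for i
  proof -
    have "b i \<le> b 1"
      unfolding b_def using that e by (intro sum_mono2) auto
    then show ?thesis by (simp only: b_start)
  qed
  have V_nonneg: "0 \<le> V x" for x
    unfolding V_def by (intro weighted_size_nonneg b_nonneg)
  have s_nonneg: "0 \<le> ?s x" for x
    by (simp add: hawkes_intensity_def)
  \<comment> \<open>With positive parts as weights the right-hand side is nonnegative, so it
    dominates both arguments of the maximum in the intensity.\<close>
  have s_le: "?s x \<le> weighted_size p (\<lambda>i. max 0 (a i)) x + lam" for x
  proof -
    have "weighted_size p a x \<le> weighted_size p (\<lambda>i. max 0 (a i)) x"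
      by (rule weighted_size_mono) auto
    moreover have "0 \<le> weighted_size p (\<lambda>i. max 0 (a i)) x"
      by (rule weighted_size_nonneg) auto
    ultimately show ?thesis
      using assms(2) by (simp add: hawkes_intensity_def weighted_size_def)
  qed
  have V_shift: "V (l # butlast x) = real l + weighted_size p (\<lambda>i. b (Suc i)) x"
    if "x \<in> hawkes_states p" for x l
    unfolding V_def using that assms(1) b_end
    by (subst weighted_size_shift) (auto simp: hawkes_states_def b_start simp del: One_nat_def)
  show ?thesis
  proof (rule harris_atom[where V = V and g = "1 - e" and L = lam and N = p and z = "replicate p 0"])
    show "set_pmf (?K x) \<subseteq> hawkes_states p" if "x \<in> hawkes_states p" for x
      using set_hawkes_kernel assms(1) that .
    show "(\<integral>\<^sup>+y. ennreal (V y) \<partial>?K x) \<le> ennreal ((1 - e) * V x + lam)"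
      if x: "x \<in> hawkes_states p" for x
    proof -
      have nn: "0 \<le> weighted_size p (\<lambda>i. b (Suc i)) x"
        by (intro weighted_size_nonneg b_nonneg)
      have "(\<integral>\<^sup>+y. ennreal (V y) \<partial>?K x)
          = (\<integral>\<^sup>+l. ennreal (real l) + ennreal (weighted_size p (\<lambda>i. b (Suc i)) x) \<partial>poisson (?s x))"
        using nn by (simp add: hawkes_kernel_def V_shift[OF x] ennreal_plus)
      also have "\<dots> = ennreal (?s x + weighted_size p (\<lambda>i. b (Suc i)) x)"
        using nn s_nonneg by (simp add: nn_integral_add nn_integral_poisson ennreal_plus)
      also have "\<dots> \<le> ennreal ((1 - e) * V x + lam)"
      proof (rule ennreal_leI)
        have "weighted_size p (\<lambda>i. max 0 (a i)) x + weighted_size p (\<lambda>i. b (Suc i)) x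
            = weighted_size p (\<lambda>i. max 0 (a i) + b (Suc i)) x"
          by (simp add: weighted_size_def sum.distrib distrib_right)
        also have "\<dots> \<le> weighted_size p (\<lambda>i. (1 - e) * b i) x"
        proof (rule weighted_size_mono)
          fix i assume i: "1 \<le> i" "i \<le> p"
          have "e * b i \<le> e" using b_le[OF i(1)] e by simp
          then show "max 0 (a i) + b (Suc i) \<le> (1 - e) * b i"
            using b_step[OF i(2)] by (simp add: left_diff_distrib)
        qed
        also have "\<dots> = (1 - e) * V x"
          by (simp add: V_def weighted_size_def sum_distrib_left mult.assoc)
        finally show "?s x + weighted_size p (\<lambda>i. b (Suc i)) x \<le> (1 - e) * V x + lam"
          using s_le[of x] by simp
      qed
      finally show ?thesis .
    qed
    show "\<exists>c>0. \<forall>x\<in>hawkes_states p. V x \<le> R \<longrightarrow> c \<le> pmf (kernel_power ?K p x) (replicate p 0)" for R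
    \<comment> \<open>On the sublevel set the intensity is at most \<open>R + lam\<close>, so a zero
      transition has probability at least \<open>exp (- (R + lam))\<close>; \<open>p\<close> of them
      are made.\<close>
    proof (intro exI[of _ "exp (- (R + lam)) ^ p"] conjI ballI impI)
      let ?h = "\<lambda>y. (0::nat) # butlast y"
      fix x assume x: "x \<in> hawkes_states p" "V x \<le> R"
      have "exp (- (R + lam)) ^ p \<le> pmf (kernel_power ?K p x) ((?h ^^ p) x)"
      proof (rule conjunct2[OF kernel_power_path_ge[where P = "\<lambda>y. y \<in> hawkes_states p \<and> V y \<le> R"]])
        fix y assume y: "y \<in> hawkes_states p \<and> V y \<le> R"
        have "weighted_size p (\<lambda>i. max 0 (a i)) y \<le> V y"
          unfolding V_def by (intro weighted_size_mono b_ge)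
        then have "?s y \<le> R + lam"
          using s_le[of y] y by simp
        then show "exp (- (R + lam)) \<le> pmf (?K y) (?h y)"
          by (simp add: pmf_hawkes_kernel_shift)
        \<comment> \<open>A zero entry adds nothing and the weights decrease along the list, so the
          path stays in the sublevel set and the same bound serves at every step.\<close>
        have "V (?h y) \<le> V y"
          using y by (subst V_shift) (auto simp: V_def intro!: weighted_size_mono b_ge)
        then show "?h y \<in> hawkes_states p \<and> V (?h y) \<le> R"
          using y assms(1) by (auto simp: hawkes_states_def)
      qed (use x in auto)
      also have "(?h ^^ p) x = replicate p 0"
        using x by (simp add: hawkes_states_def funpow_Cons_butlast)
      finally show "exp (- (R + lam)) ^ p \<le> pmf (kernel_power ?K p x) (replicate p 0)" .
    qed simp
  qed (use V_nonneg e e1 assms in \<open>auto simp: hawkes_states_def\<close>)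
qed

end
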